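(* Let $N, L \geq 1$ be integers and let $\{\mathbf{e}_l\}_{l=0}^{L-1}$ be a set of nonzero vectors in $\mathbb{C}^N$. For $l = 0,\ldots,L-1$ and $k,m = 0,\ldots,N-1$ define $\mathbf{a}_{l,k,m} \in \mathbb{C}^N$ by \[ a_{l,k,m}[n] = e_l[n-m \bmod N]\,\exp\left(2\pi j k(n-m)/N\right), \qquad n = 0,\ldots,N-1. \] Then the vectors $\{\mathbf{a}_{l,k,m}\}$ form a tight frame with constant $\alpha = N\sum_{l=0}^{L-1}\|\mathbf{e}_l\|^2$; that is, $\alpha > 0$ and \[ \sum_{l=0}^{L-1}\sum_{k=0}^{N-1}\sum_{m=0}^{N-1} |\langle \mathbf{w}, \mathbf{a}_{l,k,m}\rangle|^2 = \alpha\,\|\mathbf{w}\|^2 \quad \text{for all } \mathbf{w}\in\mathbb{C}^N. \]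
   Context: $\mathbb{C}^N$ carries the standard complex inner product $\langle\cdot,\cdot\rangle$ and $\|\cdot\|$ is the $\ell_2$ norm. Vectors are indexed from $0$: $v[n]$ (non-bold) denotes the $n$-th entry of $\mathbf{v}$, $n = 0,\ldots,N-1$. Here $j$ is the imaginary unit and $n-m \bmod N$ denotes the representative in $\{0,\ldots,N-1\}$. A tight frame with constant $\alpha>0$ is a finite family (indexed, repetitions allowed) $\{\mathbf{a}_i\}_{i=0}^{K-1}$ in $\mathbb{C}^N$ with $\sum_{i=0}^{K-1} |\langle \mathbf{w},\mathbf{a}_i\rangle|^2 = \alpha\|\mathbf{w}\|^2$ for all $\mathbf{w}\in\mathbb{C}^N$. *)

theory Defs
  imports "Jordan_Normal_Form.Matrix" "HOL-Analysis.L2_Norm"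
begin

text \<open>
  The space of complex N-tuples is \<^term>\<open>carrier_vec N :: complex vec set\<close>, with entries indexed
  from 0. Its standard inner product is \<^term>\<open>v \<bullet>c w :: complex\<close>, conjugate-linear in the
  second argument.
\<close>

definition l2_norm :: "complex vec \<Rightarrow> real" where
  "l2_norm v = L2_set (\<lambda>n. cmod (v $ n)) {..<dim_vec v}"

text \<open>A family indexed by \<^term>\<open>I\<close>; repetitions are allowed, as \<^term>\<open>a\<close> need not be injective.\<close>

definition tight_frame :: "nat \<Rightarrow> 'i set \<Rightarrow> ('i \<Rightarrow> complex vec) \<Rightarrow> real \<Rightarrow> bool" where
  "tight_frame N I a \<alpha> \<longleftrightarrow>
     finite I \<and> (\<forall>i\<in>I. a i \<in> carrier_vec N) \<and> \<alpha> > 0 \<and>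
     (\<forall>w\<in>carrier_vec N. (\<Sum>i\<in>I. (cmod (w \<bullet>c a i))\<^sup>2) = \<alpha> * (l2_norm w)\<^sup>2)"

text \<open>
  The differences of indices are taken in \<^typ>\<open>int\<close> and \<^typ>\<open>complex\<close>, since subtraction on
  \<^typ>\<open>nat\<close> truncates; \<open>mod\<close> on \<^typ>\<open>int\<close> with a positive modulus is non-negative, so
  the index lies in \<open>{0..<N}\<close>.
\<close>

definition frame_vec :: "nat \<Rightarrow> complex vec \<Rightarrow> nat \<Rightarrow> nat \<Rightarrow> complex vec" where
  "frame_vec N e k m =
     vec N (\<lambda>n. e $ nat ((int n - int m) mod int N) *
                exp (2 * of_real pi * \<i> * of_nat k * (of_nat n - of_nat m) / of_nat N))"

end

theory Submission
  imports "HOL-Analysis.Complex_Transcendental" Defs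
begin

text \<open>
  For fixed \<open>l\<close> and \<open>m\<close>, the phase \<open>exp (2 \<pi> j k m / N)\<close> does not affect the modulus of the inner
  product, so \<open>k \<mapsto> \<langle>w, a\<^bsub>l,k,m\<^esub>\<rangle>\<close> is up to phase the discrete Fourier transform of
  \<open>n \<mapsto> w[n] * cnj (e\<^sub>l[n - m])\<close>. Parseval's identity turns the sum over \<open>k\<close> into
  \<open>N * (\<Sum>n. \<bar>w[n]\<bar>\<^sup>2 * \<bar>e\<^sub>l[n - m]\<bar>\<^sup>2)\<close>, and summing over \<open>m\<close> decouples the two factors because
  \<open>m \<mapsto> n - m\<close> permutes the residues modulo \<open>N\<close>.
\<close>

text \<open>Reflection about \<open>n\<close> is an involution on the residues:
  \<open>n - (n - m) = m\<close> modulo \<open>N\<close>. The map is therefore its own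
  inverse.\<close>

lemma bij_betw_diff_mod:
  assumes "n < N"
  shows "bij_betw (\<lambda>m. nat ((int n - int m) mod int N)) {..<N} {..<N}"
proof -
  let ?f = "\<lambda>m. nat ((int n - int m) mod int N)"
  have "\<forall>m\<in>{..<N}. ?f (?f m) = m"
    using assms by (simp add: mod_diff_right_eq)
  moreover have "?f ` {..<N} \<subseteq> {..<N}"
    using assms by (auto simp: nat_less_iff)
  ultimately show ?thesis
    by (intro bij_betw_byWitness[where f' = ?f])
qed

definition unity_root :: "nat \<Rightarrow> nat \<Rightarrow> complex" where
  "unity_root N n = exp (2 * of_real pi * \<i> * of_nat n / of_nat N)"

lemma norm_unity_root [simp]: "norm (unity_root N n) = 1"
  by (simp add: unity_root_def)

lemma unity_root_power_self: "N > 0 \<Longrightarrow> unity_root N n ^ N = 1"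
  unfolding unity_root_def by (rule complex_root_unity) simp

text \<open>Orthogonality of characters: off the diagonal the ratio is an \<open>N\<close>-th root
  of unity other than 1, so its geometric sum vanishes.\<close>

lemma sum_unity_root_power:
  assumes "n < N" "n' < N"
  shows "(\<Sum>k<N. (unity_root N n * cnj (unity_root N n')) ^ k) = (if n = n' then of_nat N else 0)"
proof (cases "n = n'")
  case True
  then show ?thesis
    by (simp add: complex_norm_square[symmetric])
next
  case False
  let ?z = "unity_root N n * cnj (unity_root N n')"
  have "unity_root N n \<noteq> unity_root N n'"
    using assms False complex_root_unity_eq[of N n n'] by (simp add: unity_root_def)
  \<comment> \<open>The conjugate of a unimodular number is its inverse, so \<open>?z = 1\<close>
    would make the two roots equal.\<close>
  moreover have "unity_root N n = ?z * unity_root N n'"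
    by (simp add: mult.assoc mult.commute[of "cnj _"] complex_norm_square[symmetric])
  ultimately have "?z \<noteq> 1"
    by force
  moreover have "?z ^ N = 1"
    using assms by (simp add: power_mult_distrib unity_root_power_self flip: complex_cnj_power)
  ultimately show ?thesis
    using False by (simp add: geometric_sum)
qed

lemma dft_parseval:
  fixes f :: "nat \<Rightarrow> complex"
  shows "(\<Sum>k<N. (cmod (\<Sum>n<N. f n * cnj (unity_root N n ^ k)))\<^sup>2) = real N * (\<Sum>n<N. (cmod (f n))\<^sup>2)"
proof -
  let ?u = "unity_root N"
  \<comment> \<open>Over the complex numbers each squared modulus becomes \<open>z * cnj z\<close>
    and expands into a double sum. Summing over \<open>k\<close> first then leaves only the
    diagonal.\<close>
  have "complex_of_real (\<Sum>k<N. (cmod (\<Sum>n<N. f n * cnj (?u n ^ k)))\<^sup>2)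
      = (\<Sum>k<N. \<Sum>n<N. \<Sum>n'<N. f n * cnj (f n') * (?u n' * cnj (?u n)) ^ k)"
    unfolding of_real_sum complex_norm_square
    by (simp add: sum_product power_mult_distrib mult_ac)
  also have "\<dots> = (\<Sum>n<N. \<Sum>n'<N. \<Sum>k<N. f n * cnj (f n') * (?u n' * cnj (?u n)) ^ k)"
    by (subst sum.swap) (intro sum.cong refl sum.swap)
  also have "\<dots> = (\<Sum>n<N. \<Sum>n'<N. if n' = n then f n * cnj (f n) * of_nat N else 0)"
    by (intro sum.cong refl) (auto simp: sum_unity_root_power simp flip: sum_distrib_left)
  also have "\<dots> = complex_of_real (real N * (\<Sum>n<N. (cmod (f n))\<^sup>2))"
    unfolding of_real_mult of_real_sum complex_norm_square sum_distrib_left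
    by (simp add: mult_ac)
  finally show ?thesis
    using of_real_eq_iff by blast
qed

lemma l2_norm_power2:
  assumes "v \<in> carrier_vec N"
  shows "(l2_norm v)\<^sup>2 = (\<Sum>n<N. (cmod (vec_index v n))\<^sup>2)"
  using assms by (simp add: l2_norm_def L2_set_def sum_nonneg)

lemma l2_norm_power2_pos:
  assumes "v \<in> carrier_vec N" "v \<noteq> 0\<^sub>v N"
  shows "(l2_norm v)\<^sup>2 > 0"
proof -
  obtain i where "i < N" "vec_index v i \<noteq> 0"
    using assms by (metis carrier_vecD eq_vecI index_zero_vec)
  then show ?thesis
    unfolding l2_norm_power2[OF assms(1)] by (intro sum_pos2[of _ i]) auto
qed

lemma cmod_inner_frame_vec:
  "cmod (w \<bullet>c frame_vec N e k m) =
    cmod (\<Sum>n<N. vec_index w n * cnj (vec_index e (nat ((int n - int m) mod int N)))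
                  * cnj (unity_root N n ^ k))"
proof -
  let ?g = "\<lambda>n. vec_index w n * cnj (vec_index e (nat ((int n - int m) mod int N)))
                  * cnj (unity_root N n ^ k)"
  \<comment> \<open>The denominator is free of \<open>n\<close>, so it factors out of the inner
    product, and it has modulus 1.\<close>
  have phase: "exp (2 * of_real pi * \<i> * of_nat k * (of_nat n - of_nat m) / of_nat N)
      = unity_root N n ^ k / unity_root N m ^ k" for n
    by (simp add: unity_root_def diff_divide_distrib algebra_simps flip: exp_of_nat_mult exp_diff)
  have "w \<bullet>c frame_vec N e k m = (\<Sum>n<N. ?g n) / cnj (unity_root N m ^ k)"
    unfolding sum_divide_distrib
    by (simp add: scalar_prod_def frame_vec_def phase lessThan_atLeast0)
      (simp add: mult.assoc)
  then show ?thesis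
    by (simp add: norm_divide norm_power)
qed

lemma sum_cmod_inner_frame_vec:
  assumes "w \<in> carrier_vec N" "e \<in> carrier_vec N"
  shows "(\<Sum>k<N. \<Sum>m<N. (cmod (w \<bullet>c frame_vec N e k m))\<^sup>2) = real N * (l2_norm e)\<^sup>2 * (l2_norm w)\<^sup>2"
proof -
  let ?d = "\<lambda>n m. nat ((int n - int m) mod int N)"
  \<comment> \<open>Parseval needs \<open>k\<close> innermost, with the shift \<open>m\<close>
    fixed.\<close>
  have "(\<Sum>k<N. \<Sum>m<N. (cmod (w \<bullet>c frame_vec N e k m))\<^sup>2)
      = (\<Sum>m<N. \<Sum>k<N. (cmod (w \<bullet>c frame_vec N e k m))\<^sup>2)"
    by (rule sum.swap)
  also have "\<dots> = (\<Sum>m<N. real N * (\<Sum>n<N. (cmod (vec_index w n))\<^sup>2 * (cmod (vec_index e (?d n m)))\<^sup>2))"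
    unfolding cmod_inner_frame_vec dft_parseval
    by (simp add: norm_mult power_mult_distrib)
  also have "\<dots> = real N * (\<Sum>n<N. (cmod (vec_index w n))\<^sup>2 * (\<Sum>m<N. (cmod (vec_index e (?d n m)))\<^sup>2))"
    unfolding sum_distrib_left by (rule sum.swap)
  \<comment> \<open>For fixed \<open>n\<close>, the index \<open>?d n m\<close> meets every entry of
    \<open>e\<close> exactly once as \<open>m\<close> varies.\<close>
  also have "\<dots> = real N * (\<Sum>n<N. (cmod (vec_index w n))\<^sup>2 * (l2_norm e)\<^sup>2)"
    by (simp add: l2_norm_power2[OF assms(2)]
        sum.reindex_bij_betw[OF bij_betw_diff_mod, of _ N "\<lambda>i. (cmod (vec_index e i))\<^sup>2"])
  also have "\<dots> = real N * (l2_norm e)\<^sup>2 * (l2_norm w)\<^sup>2"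
    by (simp add: l2_norm_power2[OF assms(1)] flip: sum_distrib_right)
  finally show ?thesis .
qed

theorem theorem1:
  fixes N L :: nat and e :: "nat \<Rightarrow> complex vec"
  assumes "N \<ge> 1" and "L \<ge> 1"
    and "\<And>l. l < L \<Longrightarrow> e l \<in> carrier_vec N"
    and "\<And>l. l < L \<Longrightarrow> e l \<noteq> 0\<^sub>v N"
  shows "tight_frame N ({..<L} \<times> {..<N} \<times> {..<N}) (\<lambda>(l, k, m). frame_vec N (e l) k m)
           (real N * (\<Sum>l<L. (l2_norm (e l))\<^sup>2))"
  unfolding tight_frame_def
proof (intro conjI ballI)
  \<comment> \<open>Every summand is positive, and \<open>L \<ge> 1\<close> keeps the sum from being
    empty.\<close>
  have "(\<Sum>l<L. (l2_norm (e l))\<^sup>2) > 0"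
    using assms(2) by (intro sum_pos l2_norm_power2_pos[of _ N] assms(3,4)) (auto simp: lessThan_empty_iff)
  then show "real N * (\<Sum>l<L. (l2_norm (e l))\<^sup>2) > 0"
    using assms(1) by simp
next
  fix w :: "complex vec"
  assume w: "w \<in> carrier_vec N"
  have "(\<Sum>i\<in>{..<L} \<times> {..<N} \<times> {..<N}. (cmod (w \<bullet>c (case i of (l, k, m) \<Rightarrow> frame_vec N (e l) k m)))\<^sup>2)
      = (\<Sum>l<L. \<Sum>k<N. \<Sum>m<N. (cmod (w \<bullet>c frame_vec N (e l) k m))\<^sup>2)"
    by (simp add: sum.cartesian_product split_def)
  also have "\<dots> = (\<Sum>l<L. real N * (l2_norm (e l))\<^sup>2 * (l2_norm w)\<^sup>2)"
    using w assms(3) by (simp add: sum_cmod_inner_frame_vec)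
  also have "\<dots> = real N * (\<Sum>l<L. (l2_norm (e l))\<^sup>2) * (l2_norm w)\<^sup>2"
    by (simp add: sum_distrib_left sum_distrib_right)
  finally show "(\<Sum>i\<in>{..<L} \<times> {..<N} \<times> {..<N}. (cmod (w \<bullet>c (case i of (l, k, m) \<Rightarrow> frame_vec N (e l) k m)))\<^sup>2)
      = real N * (\<Sum>l<L. (l2_norm (e l))\<^sup>2) * (l2_norm w)\<^sup>2" .
qed (auto simp: frame_vec_def)

end
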